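(* Let $R$ be a commutative ring with $1$, let $I\subset R$ be a proper ideal, and suppose $\operatorname{diam}(GF(R))=n$. Then the following hold. (1) If $n\leq 2$, then $\operatorname{diam}(GF(R/I))\leq n$. (2) If $n=3$, then $\operatorname{diam}(GF(R/I))\leq n$. (3) If $n=4$, then $\operatorname{diam}(GF(R/I))\leq n$ or $\operatorname{diam}(GF(R/I))=\infty$.
   Context: For a commutative ring $T$ with identity, $GF(T)$ is the simple undirected graph whose vertices are the proper ideals of $T$; two distinct proper ideals have an edge between them if and only if, for one of the two orderings $(A,B)$ of the pair, $A\subset B$ and $B/A$ is a finitely generated ideal of $T/A$. The diameter $\operatorname{diam}$ of a graph is the supremum of the distances between pairs of vertices, with $\operatorname{diam}=\infty$ if the graph is not connected. The case $n=0$ corresponds to $R$ being a field (the graph is a single vertex). *)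

theory Defs
  imports
    "HOL-Algebra.QuotRing"
    "Graph_Theory.Pair_Digraph"
    "Graph_Theory.Shortest_Path"
begin

definition fin_gen_ideal :: "'a set \<Rightarrow> ('a, 'm) ring_scheme \<Rightarrow> bool" where
  "fin_gen_ideal J T \<longleftrightarrow> ideal J T \<and> (\<exists>S. finite S \<and> S \<subseteq> carrier T \<and> J = genideal T S)"

definition proper_ideals :: "('a, 'm) ring_scheme \<Rightarrow> 'a set set" where
  "proper_ideals T = {A. ideal A T \<and> A \<noteq> carrier T}"

text \<open>The image of \<open>B\<close> under \<open>b \<mapsto> A + b\<close> is the ideal \<open>B/A\<close> of \<open>T/A\<close>.\<close>

definition fg_step :: "('a, 'm) ring_scheme \<Rightarrow> 'a set \<Rightarrow> 'a set \<Rightarrow> bool" where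
  "fg_step T A B \<longleftrightarrow> A \<subset> B \<and> fin_gen_ideal ((\<lambda>b. A +>\<^bsub>T\<^esub> b) ` B) (T Quot A)"

text \<open>The undirected graph is represented, as usual in \<open>Graph_Theory\<close>, by a symmetric
  digraph: every edge appears as a pair of opposite arcs.\<close>

definition GF :: "('a, 'm) ring_scheme \<Rightarrow> 'a set pair_pre_digraph" where
  "GF T = \<lparr> pverts = proper_ideals T,
            parcs = {(A, B). A \<in> proper_ideals T \<and> B \<in> proper_ideals T \<and>
                             (fg_step T A B \<or> fg_step T B A)} \<rparr>"

text \<open>With every arc of weight 1, \<open>\<mu>\<close> is the infimum of the lengths of the walks between two
  vertices, hence \<open>\<infinity>\<close> for vertices in different components. The diameter of the graph
  without vertices is \<open>-\<infinity>\<close>; this only concerns \<open>GF\<close> of the zero ring.\<close>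

definition graph_dist :: "('a, 'b) pre_digraph \<Rightarrow> 'a \<Rightarrow> 'a \<Rightarrow> ereal" where
  "graph_dist G u v = wf_digraph.\<mu> G (\<lambda>_. 1) u v"

definition graph_diam :: "('a, 'b) pre_digraph \<Rightarrow> ereal" where
  "graph_diam G = (SUP u\<in>verts G. SUP v\<in>verts G. graph_dist G u v)"

abbreviation diam_GF :: "('a, 'm) ring_scheme \<Rightarrow> ereal" where
  "diam_GF T \<equiv> graph_diam (with_proj (GF T))"

lemma wf_digraph_GF: "wf_digraph (with_proj (GF T))"
  by unfold_locales (auto simp: GF_def)

lemma sym_digraph_GF: "sym_digraph (with_proj (GF T))"
proof -
  interpret wf_digraph "with_proj (GF T)" by (rule wf_digraph_GF)
  show ?thesis
    by unfold_locales (auto simp: GF_def symmetric_def sym_def)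
qed

lemma loopfree_digraph_GF: "loopfree_digraph (with_proj (GF T))"
proof -
  interpret wf_digraph "with_proj (GF T)" by (rule wf_digraph_GF)
  show ?thesis
    by unfold_locales (auto simp: GF_def fg_step_def)
qed

lemma graph_dist_awalk:
  assumes "wf_digraph G"
  shows "graph_dist G u v = (INF p\<in>{p. pre_digraph.awalk G u p v}. ereal (real (length p)))"
proof -
  interpret wf_digraph G by fact
  have "awalk_cost (\<lambda>_. 1) p = real (length p)" for p
    by (induct p) auto
  then show ?thesis
    by (simp add: graph_dist_def \<mu>_def)
qed

end

theory Submission
  imports Defs
begin

text \<open>
  Write \<open>A \<le>\<^sub>f B\<close> (\<open>fg_extension\<close> below) when the ideal \<open>B\<close> is generated by \<open>A\<close> and finitely
  many further elements; the edges of the graph are the pairs of distinct proper ideals related by \<open>\<le>\<^sub>f\<close> in one direction.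

  Diameter at most 3 passes to \<open>R/I\<close> because the projection carries short walks over. It preserves
  \<open>\<le>\<^sub>f\<close>, so it carries a walk of \<open>R\<close> to a walk of \<open>R/I\<close> (with possible repetitions) as soon as
  no ideal \<open>C\<close> on the walk becomes the whole ring, that is, as soon as \<open>C + I \<noteq> R\<close>. On a walk
  of length at most 3 between \<open>A, B \<supseteq> I\<close>, every ideal is equal or adjacent to an endpoint, hence
  comparable with a proper ideal that contains \<open>I\<close>, and so it stays proper
  (\<open>canonical_image_proper\<close>). A walk of length 4 has a middle vertex about which nothing of the
  kind is known.

  For \<open>n = 4\<close> there is no inheritance at all: \<^emph>\<open>every\<close> commutative ring has diameter at most 4 or
  infinite diameter (\<open>diam_GF_le_4_or_infinite\<close>), and this is applied to \<open>R/I\<close>.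

  \<^item> If proper ideals always have a proper sum (the ring is local, or zero), then a valley
    \<open>A \<ge>\<^sub>f D \<le>\<^sub>f C\<close> of a walk can be replaced by the peak \<open>A \<le>\<^sub>f A + C \<ge>\<^sub>f C\<close>. So every walk turns
    into one with a single peak, of length 2 (\<open>local_common_extension\<close>). Either all distances are
    at most 2, or the graph is disconnected.

  \<^item> If \<open>P + Q = R\<close> for proper ideals \<open>P\<close> and \<open>Q\<close>, then any two proper ideals are at distance at
    most 4 (\<open>nonlocal_walk\<close>). The reason is that comaximal ideals \<open>A\<close>, \<open>C\<close> are joined by the valley
    \<open>A \<ge>\<^sub>f A \<inter> C \<le>\<^sub>f C\<close>, because \<open>A/(A \<inter> C)\<close> is isomorphic to the cyclic module \<open>R/C\<close>. Either \<open>A\<close>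
    and \<open>B\<close> are both comaximal to one proper ideal \<open>N\<close>, and two valleys meeting at \<open>N\<close> join them,
    or they have comaximal extensions by at most one element each, which are joined by a valley.
\<close>

section \<open>Distances and walks\<close>

text \<open>The reflexive closure of the arc relation allows a walk to pause, so that its \<open>n\<close>-th power
  describes the walks of length at most \<open>n\<close>. This is also what a homomorphism yields that may
  identify neighbours.\<close>

lemma relpow_reflcl_mono:
  assumes "(u, v) \<in> E ^^ m" "m \<le> n"
  shows "(u, v) \<in> (E\<^sup>=) ^^ n"
proof -
  have "(u, v) \<in> (E\<^sup>=) ^^ m"
    using assms(1) by (induction m arbitrary: v) auto
  with assms(2) show ?thesis
    by (induction rule: dec_induct) auto
qed

lemma awalk_imp_relpow:
  assumes "wf_digraph (with_proj G)" "pre_digraph.awalk (with_proj G) u p v"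
  shows "(u, v) \<in> (parcs G) ^^ length p"
  using assms(2)
proof (induction p arbitrary: u)
  case Nil
  interpret wf_digraph "with_proj G" by fact
  show ?case using Nil by (simp add: awalk_Nil_iff)
next
  case (Cons e p)
  interpret wf_digraph "with_proj G" by fact
  have "e \<in> parcs G" "fst e = u" "pre_digraph.awalk (with_proj G) (snd e) p v"
    using Cons.prems by (auto simp: awalk_Cons_iff)
  then show ?case using Cons.IH by (metis length_Cons prod.collapse relpow_Suc_I2)
qed

lemma relpow_imp_awalk:
  assumes "wf_digraph (with_proj G)" "u \<in> pverts G"
    and "(u, v) \<in> ((parcs G)\<^sup>=) ^^ n"
  shows "\<exists>p. pre_digraph.awalk (with_proj G) u p v \<and> length p \<le> n"
  using assms(2,3)
proof (induction n arbitrary: u)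
  case 0
  interpret wf_digraph "with_proj G" by fact
  show ?case using 0 by (auto simp: awalk_Nil_iff)
next
  case (Suc n)
  interpret wf_digraph "with_proj G" by fact
  obtain w where w: "(u, w) \<in> (parcs G)\<^sup>=" "(w, v) \<in> ((parcs G)\<^sup>=) ^^ n"
    using Suc.prems(2) by (meson relpow_Suc_E2)
  have "w \<in> pverts G"
    using w(1) Suc.prems(1) head_in_verts[of "(u, w)"] by auto
  then obtain p where p: "awalk w p v" "length p \<le> n"
    using Suc.IH w(2) by blast
  show ?case
  proof (cases "u = w")
    case True
    then show ?thesis using p by (metis le_SucI)
  next
    case False
    then have "awalk u ((u, w) # p) v"
      using w(1) p(1) by (auto simp: awalk_Cons_iff)
    then show ?thesis using p(2) by (metis length_Cons Suc_le_mono)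
  qed
qed

lemma graph_dist_le_iff:
  assumes wf: "wf_digraph (with_proj G)" and u: "u \<in> pverts G"
  shows "graph_dist (with_proj G) u v \<le> ereal (real n) \<longleftrightarrow> (u, v) \<in> ((parcs G)\<^sup>=) ^^ n"
proof
  assume le: "graph_dist (with_proj G) u v \<le> ereal (real n)"
  have "\<exists>p. pre_digraph.awalk (with_proj G) u p v \<and> length p \<le> n"
  proof (rule ccontr)
    assume "\<not> ?thesis"
    then have "ereal (real (Suc n)) \<le> graph_dist (with_proj G) u v"
      unfolding graph_dist_awalk[OF wf]
      by (intro INF_greatest) (auto simp: not_le)
    from this le have "ereal (real (Suc n)) \<le> ereal (real n)" by (rule order_trans)
    then show False by simp
  qed
  then obtain p where p: "pre_digraph.awalk (with_proj G) u p v" "length p \<le> n" by blast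
  show "(u, v) \<in> ((parcs G)\<^sup>=) ^^ n"
    by (rule relpow_reflcl_mono[OF awalk_imp_relpow[OF wf p(1)] p(2)])
next
  assume "(u, v) \<in> ((parcs G)\<^sup>=) ^^ n"
  then obtain p where p: "pre_digraph.awalk (with_proj G) u p v" "length p \<le> n"
    using relpow_imp_awalk[OF wf u] by blast
  then have "graph_dist (with_proj G) u v \<le> ereal (real (length p))"
    unfolding graph_dist_awalk[OF wf] by (intro INF_lower) simp
  with p(2) show "graph_dist (with_proj G) u v \<le> ereal (real n)"
    by (auto elim: order_trans)
qed

lemma graph_diam_le_iff:
  assumes "wf_digraph (with_proj G)"
  shows "graph_diam (with_proj G) \<le> ereal (real n) \<longleftrightarrow>
    (\<forall>u\<in>pverts G. \<forall>v\<in>pverts G. (u, v) \<in> ((parcs G)\<^sup>=) ^^ n)"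
  unfolding graph_diam_def by (simp add: SUP_le_iff graph_dist_le_iff[OF assms])

text \<open>No walk at all means that the infimum that defines the distance is over the empty set.\<close>

lemma graph_diam_infinite:
  assumes wf: "wf_digraph (with_proj G)" and uv: "u \<in> pverts G" "v \<in> pverts G"
    and no: "\<And>n. (u, v) \<notin> ((parcs G)\<^sup>=) ^^ n"
  shows "graph_diam (with_proj G) = \<infinity>"
proof -
  have "{p. pre_digraph.awalk (with_proj G) u p v} = {}"
    using relpow_reflcl_mono[OF awalk_imp_relpow[OF wf] order_refl] no by blast
  then have "graph_dist (with_proj G) u v = \<infinity>"
    unfolding graph_dist_awalk[OF wf] by (simp add: top_ereal_def)
  moreover have "graph_dist (with_proj G) u v \<le> graph_diam (with_proj G)"
    unfolding graph_diam_def using uv by (intro SUP_upper2[of u] SUP_upper) auto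
  ultimately show ?thesis by simp
qed

lemma relpow_2_iff: "(a, c) \<in> E ^^ 2 \<longleftrightarrow> (\<exists>b. (a, b) \<in> E \<and> (b, c) \<in> E)"
  by (auto simp: eval_nat_numeral)

lemma relpow_3_iff: "(a, d) \<in> E ^^ 3 \<longleftrightarrow> (\<exists>b c. (a, b) \<in> E \<and> (b, c) \<in> E \<and> (c, d) \<in> E)"
  by (auto simp: eval_nat_numeral)

lemma relpow_4I:
  assumes "(a, b) \<in> E" "(b, c) \<in> E" "(c, d) \<in> E" "(d, e) \<in> E"
  shows "(a, e) \<in> E ^^ 4"
  using assms by (auto simp: eval_nat_numeral)

section \<open>Finitely generated extensions of ideals\<close>

text \<open>The case \<open>B = A\<close> is included, which makes the relation reflexive and lets degenerate steps of
  a walk be treated like all others.\<close>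

definition fg_extension :: "('a, 'm) ring_scheme \<Rightarrow> 'a set \<Rightarrow> 'a set \<Rightarrow> bool" where
  "fg_extension T A B \<longleftrightarrow> (\<exists>S. finite S \<and> S \<subseteq> carrier T \<and> B = genideal T (A \<union> S))"

lemma fg_extensionE:
  assumes "fg_extension T A B"
  obtains S where "finite S" "S \<subseteq> carrier T" "B = genideal T (A \<union> S)"
  using assms by (auto simp: fg_extension_def)

lemma pverts_GF: "pverts (GF T) = proper_ideals T"
  by (simp add: GF_def)

lemma proper_idealsD:
  assumes "A \<in> proper_ideals T"
  shows "ideal A T" "A \<subseteq> carrier T" "A \<noteq> carrier T"
  using assms ideal.Icarr[of A T] by (auto simp: proper_ideals_def)

context ring
begin

lemma ideal_subset_carrier: "ideal A R \<Longrightarrow> A \<subseteq> carrier R"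
  using ideal.Icarr[of A R] by blast

lemma proper_ideals_subset:
  assumes "ideal A R" "A \<subseteq> B" "B \<in> proper_ideals R"
  shows "A \<in> proper_ideals R"
  using assms ideal_subset_carrier by (auto simp: proper_ideals_def)

lemma genideal_eqI:
  assumes "ideal B R" "X \<subseteq> B" "\<And>J. ideal J R \<Longrightarrow> X \<subseteq> J \<Longrightarrow> B \<subseteq> J"
  shows "B = Idl X"
  using assms unfolding genideal_def by blast

lemma genideal_of_ideal: "ideal A R \<Longrightarrow> Idl A = A"
  by (rule genideal_eqI[symmetric]) auto

lemma genideal_Un_genideal:
  assumes "X \<subseteq> carrier R" "Y \<subseteq> carrier R"
  shows "Idl (Idl X \<union> Y) = Idl (X \<union> Y)"
proof (rule genideal_eqI)
  show "ideal (Idl (Idl X \<union> Y)) R"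
    using assms genideal_ideal ideal_subset_carrier by (metis Un_least)
  have "Idl X \<union> Y \<subseteq> carrier R"
    using assms genideal_ideal ideal_subset_carrier by (metis Un_least)
  then have "Idl X \<union> Y \<subseteq> Idl (Idl X \<union> Y)" by (rule genideal_self)
  then show "X \<union> Y \<subseteq> Idl (Idl X \<union> Y)"
    using genideal_self[OF assms(1)] by auto
  fix J assume "ideal J R" "X \<union> Y \<subseteq> J"
  then show "Idl (Idl X \<union> Y) \<subseteq> J"
    by (simp add: genideal_minimal)
qed

text \<open>An ideal that contains \<open>I\<close> is a union of cosets of \<open>I\<close>, so its image determines it.\<close>

lemma canonical_image_mem_iff:
  assumes "ideal I R" "ideal J R" "I \<subseteq> J" "b \<in> carrier R"
  shows "I +> b \<in> (+>) I ` J \<longleftrightarrow> b \<in> J"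
proof
  assume "I +> b \<in> (+>) I ` J"
  then obtain j where j: "j \<in> J" "I +> b = I +> j" by blast
  then have "b \<in> I +> j"
    using assms by (metis abelian_subgroup.a_rcos_self abelian_subgroupI3 ideal.axioms(1)
        is_abelian_group)
  then show "b \<in> J"
    using j(1) assms ideal_incl_iff by blast
qed blast

text \<open>Both inclusions are minimality: the preimage of the right-hand side is an ideal containing
  \<open>S\<close>, and the left-hand side is an ideal because the projection is onto.\<close>

lemma canonical_image_genideal:
  assumes I: "ideal I R" and S: "S \<subseteq> carrier R"
  shows "(+>) I ` (Idl S) = Idl\<^bsub>R Quot I\<^esub> ((+>) I ` S)"
proof -
  interpret Q: ring "R Quot I" using I by (rule ideal.quotient_is_ring)
  interpret h: ring_hom_ring R "R Quot I" "(+>) I" using I by (rule ideal.rcos_ring_hom_ring)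
  have img: "(+>) I ` S \<subseteq> carrier (R Quot I)" using S by auto
  show ?thesis
  proof
    let ?V = "{r \<in> carrier R. I +> r \<in> Idl\<^bsub>R Quot I\<^esub> ((+>) I ` S)}"
    have "ideal ?V R"
      by (rule h.ideal_vimage[OF Q.genideal_ideal[OF img]])
    moreover have "S \<subseteq> ?V"
      using S Q.genideal_self[OF img] by auto
    ultimately have "Idl S \<subseteq> ?V" by (rule genideal_minimal)
    then show "(+>) I ` (Idl S) \<subseteq> Idl\<^bsub>R Quot I\<^esub> ((+>) I ` S)" by auto
    show "Idl\<^bsub>R Quot I\<^esub> ((+>) I ` S) \<subseteq> (+>) I ` (Idl S)"
      using S by (intro Q.genideal_minimal ring_ideal_imp_quot_ideal I genideal_ideal
          image_mono genideal_self)
  qed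
qed

lemma fg_extension_subset:
  assumes "A \<subseteq> carrier R" "fg_extension R A B"
  shows "A \<subseteq> B"
proof -
  obtain S where S: "S \<subseteq> carrier R" "B = Idl (A \<union> S)"
    using assms(2) by (rule fg_extensionE)
  then show ?thesis using genideal_self[of "A \<union> S"] assms(1) by auto
qed

lemma fg_extension_refl: "ideal A R \<Longrightarrow> fg_extension R A A"
  unfolding fg_extension_def by (intro exI[of _ "{}"]) (simp add: genideal_of_ideal)

lemma fg_extension_trans:
  assumes "A \<subseteq> carrier R" "fg_extension R A B" "fg_extension R B C"
  shows "fg_extension R A C"
proof -
  obtain S where S: "finite S" "S \<subseteq> carrier R" "B = Idl (A \<union> S)"
    using assms(2) by (rule fg_extensionE)
  obtain S' where S': "finite S'" "S' \<subseteq> carrier R" "C = Idl (B \<union> S')"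
    using assms(3) by (rule fg_extensionE)
  have "C = Idl (A \<union> (S \<union> S'))"
    using assms(1) S S' genideal_Un_genideal[of "A \<union> S" S'] by (simp add: Un_assoc)
  then show ?thesis
    unfolding fg_extension_def using S S' by (intro exI[of _ "S \<union> S'"]) simp
qed

text \<open>The generators of \<open>C\<close> over \<open>D\<close> also generate \<open>A + C\<close> over the larger ideal \<open>A\<close>. This is what
  exchanges a valley \<open>A \<ge>\<^sub>f D \<le>\<^sub>f C\<close> for a peak \<open>A \<le>\<^sub>f A + C \<ge>\<^sub>f C\<close>.\<close>

lemma fg_extension_join:
  assumes D: "ideal D R" and A: "ideal A R" "D \<subseteq> A" and DC: "fg_extension R D C"
  shows "fg_extension R A (Idl (A \<union> C))"
proof -
  obtain S where S: "finite S" "S \<subseteq> carrier R" "C = Idl (D \<union> S)"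
    using DC by (rule fg_extensionE)
  have "Idl (A \<union> C) = Idl ((D \<union> S) \<union> A)"
    using genideal_Un_genideal[of "D \<union> S" A] S ideal_subset_carrier[OF A(1)]
      ideal_subset_carrier[OF D] by (simp add: Un_commute)
  also have "(D \<union> S) \<union> A = A \<union> S" using A(2) by auto
  finally show ?thesis
    unfolding fg_extension_def using S by (intro exI[of _ S]) simp
qed

lemma fg_extension_canonical_image:
  assumes "ideal I R" "A \<subseteq> carrier R" "fg_extension R A B"
  shows "fg_extension (R Quot I) ((+>) I ` A) ((+>) I ` B)"
proof -
  interpret h: ring_hom_ring R "R Quot I" "(+>) I"
    using assms(1) by (rule ideal.rcos_ring_hom_ring)
  obtain S where S: "finite S" "S \<subseteq> carrier R" "B = Idl (A \<union> S)"
    using assms(3) by (rule fg_extensionE)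
  show ?thesis
    unfolding fg_extension_def
  proof (intro exI[of _ "(+>) I ` S"] conjI)
    show "(+>) I ` B = Idl\<^bsub>R Quot I\<^esub> ((+>) I ` A \<union> (+>) I ` S)"
      using S assms canonical_image_genideal[of I "A \<union> S"] by (simp add: image_Un)
  qed (use S in auto)
qed

text \<open>This replaces the quotient in the definition of an edge by a statement about ideals of one
  ring: finitely many generators of \<open>B/A\<close> lift to elements of \<open>B\<close>, which generate \<open>B\<close>
  together with \<open>A\<close>.\<close>

lemma fg_step_iff:
  assumes A: "ideal A R" and B: "ideal B R"
  shows "fg_step R A B \<longleftrightarrow> A \<subset> B \<and> fg_extension R A B"
proof -
  interpret Q: ring "R Quot A" using A by (rule ideal.quotient_is_ring)
  interpret h: ring_hom_ring R "R Quot A" "(+>) A" using A by (rule ideal.rcos_ring_hom_ring)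
  note Ac = ideal_subset_carrier[OF A] and Bc = ideal_subset_carrier[OF B]
  have "fg_extension R A B" if AB: "A \<subset> B" and F: "finite F" "F \<subseteq> carrier (R Quot A)"
    "(+>) A ` B = Idl\<^bsub>R Quot A\<^esub> F" for F
  proof -
    have "F \<subseteq> (+>) A ` B" using F(3) Q.genideal_self[OF F(2)] by simp
    then obtain S where S: "S \<subseteq> B" "finite S" "F = (+>) A ` S"
      using finite_subset_image[OF F(1)] by metis
    have Sc: "A \<union> S \<subseteq> carrier R" using S(1) Ac Bc by blast
    have id: "ideal (Idl (A \<union> S)) R" using Sc by (rule genideal_ideal)
    have "Idl (A \<union> S) \<subseteq> B" using B AB S(1) by (intro genideal_minimal) auto
    moreover have "b \<in> Idl (A \<union> S)" if b: "b \<in> B" for b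
    proof -
      have "A +> b \<in> (+>) A ` (Idl S)"
        using b F(3) S(3) canonical_image_genideal[OF A, of S] Sc by auto
      also have "\<dots> \<subseteq> (+>) A ` (Idl (A \<union> S))"
        using Sc genideal_self[OF Sc] by (intro image_mono genideal_minimal id) auto
      finally show ?thesis
        using canonical_image_mem_iff[OF A id, of b] genideal_self[OF Sc] b Bc by auto
    qed
    ultimately have "B = Idl (A \<union> S)" by auto
    then show ?thesis
      unfolding fg_extension_def using S(2) Sc by (intro exI[of _ S]) simp
  qed
  moreover have "fin_gen_ideal ((+>) A ` B) (R Quot A)" if "fg_extension R A B"
  proof -
    obtain S where S: "finite S" "S \<subseteq> carrier R" "B = Idl (A \<union> S)"
      using \<open>fg_extension R A B\<close> by (rule fg_extensionE)
    \<comment> \<open>All of \<open>A\<close> becomes the single element zero, so \<open>A \<union> S\<close> has a finite image.\<close>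
    have "(+>) A ` A \<subseteq> {A}"
      using A by (auto simp: a_rcos_zero)
    then have "finite ((+>) A ` (A \<union> S))"
      using S(1) by (auto simp: image_Un intro: finite_subset)
    moreover have "(+>) A ` (A \<union> S) \<subseteq> carrier (R Quot A)" using Ac S(2) by auto
    moreover have "(+>) A ` B = Idl\<^bsub>R Quot A\<^esub> ((+>) A ` (A \<union> S))"
      using S Ac canonical_image_genideal[OF A, of "A \<union> S"] by simp
    ultimately show ?thesis
      unfolding fin_gen_ideal_def using ring_ideal_imp_quot_ideal[OF A B]
      by (intro conjI exI[of _ "(+>) A ` (A \<union> S)"])
  qed
  ultimately show ?thesis
    unfolding fg_step_def fin_gen_ideal_def by metis
qed

lemma GF_reflcl_iff:
  assumes "A \<in> proper_ideals R"
  shows "(A, B) \<in> (parcs (GF R))\<^sup>= \<longleftrightarrow>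
    B \<in> proper_ideals R \<and> (fg_extension R A B \<or> fg_extension R B A)"
proof -
  have "A \<subseteq> B" if "fg_extension R A B" "A \<in> proper_ideals R" for A B
    using fg_extension_subset[OF proper_idealsD(2)[OF that(2)] that(1)] .
  then show ?thesis
    using assms fg_extension_refl[of A] fg_step_iff[of A B] fg_step_iff[of B A]
      proper_idealsD[OF assms] proper_idealsD[of B]
    by (auto simp: GF_def)
qed

section \<open>Passing to a quotient ring\<close>

text \<open>If \<open>C\<close> is comparable with \<open>A \<supseteq> I\<close>, then the larger one of the two is a proper ideal that
  contains both \<open>C\<close> and \<open>I\<close>, so that \<open>C + I\<close> is proper.\<close>

lemma canonical_image_proper:
  assumes I: "ideal I R" and C: "C \<in> proper_ideals R" and A: "A \<in> proper_ideals R" "I \<subseteq> A"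
    and AC: "A \<subseteq> C \<or> C \<subseteq> A"
  shows "(+>) I ` C \<in> proper_ideals (R Quot I)"
proof -
  \<comment> \<open>By comparability this union is the larger one of \<open>A\<close> and \<open>C\<close>.\<close>
  define J where "J = A \<union> C"
  have J: "ideal J R" "I \<subseteq> J" "J \<noteq> carrier R" "C \<subseteq> J"
    using AC A C by (auto simp: J_def proper_ideals_def sup_absorb1 sup_absorb2)
  then obtain b where b: "b \<in> carrier R" "b \<notin> J" using ideal_subset_carrier[OF J(1)] by auto
  then have "I +> b \<notin> (+>) I ` J" using canonical_image_mem_iff[OF I J(1,2) b(1)] by simp
  then have "I +> b \<notin> (+>) I ` C" using J(4) by blast
  moreover have "I +> b \<in> carrier (R Quot I)"
    using b(1) ideal.rcos_ring_hom[OF I] by (simp add: ring_hom_closed)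
  moreover have "ideal ((+>) I ` C) (R Quot I)"
    using ring_ideal_imp_quot_ideal[OF I proper_idealsD(1)[OF C]] .
  ultimately show ?thesis by (auto simp: proper_ideals_def)
qed

lemma canonical_image_GF_reflcl:
  assumes I: "ideal I R" and A: "A \<in> proper_ideals R" and AB: "(A, B) \<in> (parcs (GF R))\<^sup>="
    and img: "(+>) I ` A \<in> proper_ideals (R Quot I)" "(+>) I ` B \<in> proper_ideals (R Quot I)"
  shows "((+>) I ` A, (+>) I ` B) \<in> (parcs (GF (R Quot I)))\<^sup>="
proof -
  have B: "B \<in> proper_ideals R" "fg_extension R A B \<or> fg_extension R B A"
    using AB GF_reflcl_iff[OF A] by auto
  then show ?thesis
    unfolding ring.GF_reflcl_iff[OF ideal.quotient_is_ring[OF I] img(1)]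
    using img(2) fg_extension_canonical_image[OF I proper_idealsD(2)[OF A]]
      fg_extension_canonical_image[OF I proper_idealsD(2)[OF B(1)]] by auto
qed

lemma proper_ideal_of_quotient:
  assumes I: "ideal I R" and K: "K \<in> proper_ideals (R Quot I)"
  obtains A where "A \<in> proper_ideals R" "I \<subseteq> A" "K = (+>) I ` A"
proof -
  have "K \<in> (\<lambda>J. (+>) I ` J) ` {J. ideal J R \<and> I \<subseteq> J}"
    using bij_betw_imp_surj_on[OF quot_ideal_correspondence[OF I]] K
    by (simp add: proper_ideals_def)
  then obtain A where A: "ideal A R" "I \<subseteq> A" "K = (+>) I ` A" by auto
  have "(+>) I ` carrier R = carrier (R Quot I)"
    by (auto simp: FactRing_def A_RCOSETS_def' )
  then have "A \<noteq> carrier R" using A(3) K by (auto simp: proper_ideals_def)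
  with A that show thesis by (auto simp: proper_ideals_def)
qed

text \<open>The bound 3 is the largest length for which every vertex of a walk is an endpoint or next
  to one.\<close>

lemma diam_GF_quotient_le:
  assumes I: "ideal I R" and n: "n \<le> 3" and diam: "diam_GF R \<le> ereal (real n)"
  shows "diam_GF (R Quot I) \<le> ereal (real n)"
proof -
  have "(K, L) \<in> ((parcs (GF (R Quot I)))\<^sup>=) ^^ n"
    if KL: "K \<in> proper_ideals (R Quot I)" "L \<in> proper_ideals (R Quot I)" for K L
  proof -
    obtain A where A: "A \<in> proper_ideals R" "I \<subseteq> A" "K = (+>) I ` A"
      using proper_ideal_of_quotient[OF I KL(1)] .
    obtain B where B: "B \<in> proper_ideals R" "I \<subseteq> B" "L = (+>) I ` B"
      using proper_ideal_of_quotient[OF I KL(2)] .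
    let ?E = "(parcs (GF R))\<^sup>=" and ?F = "(parcs (GF (R Quot I)))\<^sup>="
    let ?h = "\<lambda>C. (+>) I ` C"
    have walk: "(A, B) \<in> ?E ^^ n"
      using diam A(1) B(1) by (simp add: graph_diam_le_iff[OF wf_digraph_GF] pverts_GF)
    have good: "C \<in> proper_ideals R \<and> ?h C \<in> proper_ideals (R Quot I)"
      if "D \<in> proper_ideals R" "I \<subseteq> D" "(D, C) \<in> ?E \<or> (C, D) \<in> ?E" for C D
    proof -
      have "(D, C) \<in> ?E" using that(3) by (auto simp: GF_def)
      then have C: "C \<in> proper_ideals R" "fg_extension R D C \<or> fg_extension R C D"
        using GF_reflcl_iff[OF that(1)] by auto
      then have "D \<subseteq> C \<or> C \<subseteq> D"
        using fg_extension_subset proper_idealsD(2)[OF that(1)] proper_idealsD(2)[OF C(1)] by auto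
      then show ?thesis using canonical_image_proper[OF I C(1) that(1,2)] C(1) by blast
    qed
    note img = canonical_image_GF_reflcl[OF I]
    consider "n = 0" | "n = 1" | "n = 2" | "n = 3" using n by linarith
    then show ?thesis
    proof cases
      case 1 then show ?thesis using walk A B by simp
    next
      case 2 then show ?thesis using walk A B img[of A B] KL by simp
    next
      case 3
      then obtain C where C: "(A, C) \<in> ?E" "(C, B) \<in> ?E"
        using walk unfolding \<open>n = 2\<close> relpow_2_iff by iprover
      have C': "C \<in> proper_ideals R" "?h C \<in> proper_ideals (R Quot I)"
        using good[OF A(1,2) disjI1[OF C(1)]] by auto
      have "(?h A, ?h C) \<in> ?F" "(?h C, ?h B) \<in> ?F"
        using img[OF A(1) C(1)] img[OF C'(1) C(2)] C'(2) KL A(3) B(3) by auto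
      then show ?thesis unfolding \<open>n = 2\<close> A(3) B(3) relpow_2_iff by iprover
    next
      case 4
      then obtain C D where C: "(A, C) \<in> ?E" "(C, D) \<in> ?E" "(D, B) \<in> ?E"
        using walk unfolding \<open>n = 3\<close> relpow_3_iff by iprover
      have C': "C \<in> proper_ideals R" "?h C \<in> proper_ideals (R Quot I)"
        using good[OF A(1,2) disjI1[OF C(1)]] by auto
      have D': "D \<in> proper_ideals R" "?h D \<in> proper_ideals (R Quot I)"
        using good[OF B(1,2) disjI2[OF C(3)]] by auto
      have "(?h A, ?h C) \<in> ?F" "(?h C, ?h D) \<in> ?F" "(?h D, ?h B) \<in> ?F"
        using img[OF A(1) C(1)] img[OF C'(1) C(2)] img[OF D'(1) C(3)] C'(2) D'(2) KL A(3) B(3)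
        by auto
      then show ?thesis unfolding \<open>n = 3\<close> A(3) B(3) relpow_3_iff by iprover
    qed
  qed
  then show ?thesis by (simp add: graph_diam_le_iff[OF wf_digraph_GF] pverts_GF)
qed

section \<open>The diameter is at most 4 or infinite\<close>

lemma GF_reflclI:
  assumes "A \<in> proper_ideals R" "B \<in> proper_ideals R" "fg_extension R A B"
  shows "(A, B) \<in> (parcs (GF R))\<^sup>=" "(B, A) \<in> (parcs (GF R))\<^sup>="
  using assms GF_reflcl_iff[OF assms(1)] GF_reflcl_iff[OF assms(2)] by simp_all

lemma GF_relpow_proper:
  assumes "A \<in> proper_ideals R" "(A, B) \<in> ((parcs (GF R))\<^sup>=) ^^ n"
  shows "B \<in> proper_ideals R"
  using assms(2)
proof (induction n arbitrary: B)
  case 0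
  then show ?case using assms(1) by simp
next
  case (Suc n)
  then obtain C where C: "C \<in> proper_ideals R" "(C, B) \<in> (parcs (GF R))\<^sup>="
    by (auto elim: relpow_Suc_E simp del: reflcl_set_eq)
  then show ?case using GF_reflcl_iff[OF C(1)] by simp
qed

text \<open>The peak \<open>U\<close> is carried along the walk. A step up from \<open>C\<close> to \<open>B\<close> makes \<open>C\<close> a valley between
  \<open>U\<close> and \<open>B\<close>, and \<open>U + B\<close>, proper by locality, is the new peak; after a step down the old peak
  still works.\<close>

lemma local_common_extension:
  assumes local: "\<And>A B. A \<in> proper_ideals R \<Longrightarrow> B \<in> proper_ideals R \<Longrightarrow>
      Idl (A \<union> B) \<noteq> carrier R"
    and A: "A \<in> proper_ideals R" and walk: "(A, B) \<in> ((parcs (GF R))\<^sup>=) ^^ n"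
  shows "\<exists>U\<in>proper_ideals R. fg_extension R A U \<and> fg_extension R B U"
  using walk
proof (induction n arbitrary: B)
  case 0
  then show ?case using A fg_extension_refl proper_idealsD(1) by auto
next
  case (Suc n)
  then obtain C where C: "(A, C) \<in> ((parcs (GF R))\<^sup>=) ^^ n" "(C, B) \<in> (parcs (GF R))\<^sup>="
    by auto
  then obtain U where U: "U \<in> proper_ideals R" "fg_extension R A U" "fg_extension R C U"
    using Suc.IH by auto
  have Cp: "C \<in> proper_ideals R"
    by (rule GF_relpow_proper[OF A C(1)])
  note Cc = proper_idealsD(1)[OF Cp]
  have B: "B \<in> proper_ideals R" "fg_extension R C B \<or> fg_extension R B C"
    using C(2) GF_reflcl_iff[OF Cp] by auto
  show ?case
  proof (cases "fg_extension R C B")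
    case True
    let ?V = "Idl (U \<union> B)"
    have "U \<union> B \<subseteq> carrier R" using proper_idealsD(2)[OF U(1)] proper_idealsD(2)[OF B(1)] by auto
    then have "?V \<in> proper_ideals R"
      using local[OF U(1) B(1)] genideal_ideal by (simp add: proper_ideals_def)
    moreover have "C \<subseteq> U" "C \<subseteq> B"
      using True U(3) fg_extension_subset proper_idealsD(2)[OF Cp] by auto
    then have "fg_extension R U ?V" "fg_extension R B ?V"
      using fg_extension_join[OF Cc, of U B] fg_extension_join[OF Cc, of B U] True U(1,3)
        B(1) proper_idealsD(1) by (auto simp: Un_commute)
    ultimately show ?thesis
      using fg_extension_trans[OF proper_idealsD(2)[OF A] U(2)] by auto
  next
    case False
    then have "fg_extension R B U"
      using B fg_extension_trans[OF proper_idealsD(2)[OF B(1)] _ U(3)] by simp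
    then show ?thesis using U by auto
  qed
qed

end

context cring
begin

text \<open>If \<open>1 = a + b\<close> with \<open>a \<in> A\<close> and \<open>b \<in> B\<close>, then \<open>x = x a + x b\<close> shows that \<open>a\<close> alone generates
  \<open>A\<close> over \<open>A \<inter> B\<close>.\<close>

lemma fg_extension_inter_comaximal:
  assumes A: "ideal A R" and B: "ideal B R" and comax: "Idl (A \<union> B) = carrier R"
  shows "fg_extension R (A \<inter> B) A"
proof -
  have "\<one> \<in> A <+>\<^bsub>R\<^esub> B"
    using comax union_genideal[OF A B] by simp
  then obtain a b where ab: "a \<in> A" "b \<in> B" "\<one> = a \<oplus> b"
    by (auto simp: set_add_def')
  note c = ideal.Icarr[OF A] ideal.Icarr[OF B]
  have "A = Idl (A \<inter> B \<union> {a})"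
  proof (rule genideal_eqI[OF A])
    fix J assume J: "ideal J R" "A \<inter> B \<union> {a} \<subseteq> J"
    show "A \<subseteq> J"
    proof
      fix x assume x: "x \<in> A"
      have "x = x \<otimes> a \<oplus> x \<otimes> b"
        using x ab c by (metis r_distr r_one)
      moreover have "x \<otimes> a \<in> J"
        using J x ab c by (simp add: ideal.I_l_closed)
      moreover have "x \<otimes> b \<in> J"
        using J x ab c ideal.I_l_closed[OF B ab(2), of x] ideal.I_r_closed[OF A x, of b] by auto
      ultimately show "x \<in> J"
        using additive_subgroup.a_closed[OF ideal.axioms(1)[OF J(1)]] by metis
    qed
  qed (use ab in auto)
  then show ?thesis
    unfolding fg_extension_def using c ab(1) by (intro exI[of _ "{a}"]) auto
qed

lemma comaximal_walk:
  assumes A: "A \<in> proper_ideals R" and B: "B \<in> proper_ideals R"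
    and comax: "Idl (A \<union> B) = carrier R"
  shows "\<exists>D. (A, D) \<in> (parcs (GF R))\<^sup>= \<and> (D, B) \<in> (parcs (GF R))\<^sup>="
proof -
  have D: "A \<inter> B \<in> proper_ideals R"
    using i_intersect[of A B] A B by (intro proper_ideals_subset[OF _ _ A]) (auto dest: proper_idealsD)
  have "fg_extension R (A \<inter> B) A" "fg_extension R (A \<inter> B) B"
    using fg_extension_inter_comaximal[of A B] fg_extension_inter_comaximal[of B A] comax
      A B proper_idealsD(1) by (auto simp: Un_commute Int_commute)
  then show ?thesis using GF_reflclI[OF D A] GF_reflclI[OF D B] by auto
qed

lemma comaximal_extensions_walk:
  assumes "A \<in> proper_ideals R" "A' \<in> proper_ideals R" "fg_extension R A A'"
    and "B \<in> proper_ideals R" "B' \<in> proper_ideals R" "fg_extension R B B'"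
    and "Idl (A' \<union> B') = carrier R"
  shows "(A, B) \<in> ((parcs (GF R))\<^sup>=) ^^ 4"
proof -
  obtain D where "(A', D) \<in> (parcs (GF R))\<^sup>=" "(D, B') \<in> (parcs (GF R))\<^sup>="
    using comaximal_walk[OF assms(2,5,7)] by auto
  with GF_reflclI(1)[OF assms(1-3)] show ?thesis
    using GF_reflclI(2)[OF assms(4-6)] by (rule relpow_4I)
qed

lemma comaximal_common_walk:
  assumes "A \<in> proper_ideals R" "B \<in> proper_ideals R" "N \<in> proper_ideals R"
    and "Idl (A \<union> N) = carrier R" "Idl (B \<union> N) = carrier R"
  shows "(A, B) \<in> ((parcs (GF R))\<^sup>=) ^^ 4"
proof -
  obtain D where "(A, D) \<in> (parcs (GF R))\<^sup>=" "(D, N) \<in> (parcs (GF R))\<^sup>="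
    using comaximal_walk[OF assms(1,3,4)] by auto
  moreover obtain D' where "(N, D') \<in> (parcs (GF R))\<^sup>=" "(D', B) \<in> (parcs (GF R))\<^sup>="
    using comaximal_walk[of N B] assms by (auto simp: Un_commute)
  ultimately show ?thesis by (rule relpow_4I)
qed

text \<open>Write \<open>1 = p + q\<close> with \<open>p \<in> P\<close> and \<open>q \<in> Q\<close>. The four ideals \<open>A + (p)\<close>, \<open>A + (q)\<close>, \<open>B + (p)\<close>,
  \<open>B + (q)\<close> decide which walk to take. If \<open>A + (p)\<close> and \<open>B + (p)\<close> are both \<open>R\<close>, then \<open>P\<close> is comaximal to
  \<open>A\<close> and \<open>B\<close>. If only \<open>A + (p)\<close> is \<open>R\<close>, then \<open>A\<close> is comaximal to the proper ideal \<open>B + (p)\<close>, and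
  symmetrically. If both are proper, then either \<open>A + (q)\<close> and \<open>B + (q)\<close> are both \<open>R\<close>, which is the
  first case for \<open>Q\<close>, or one of them is proper and is comaximal to the extension by \<open>p\<close> of the
  other ideal, since \<open>p + q = 1\<close>.\<close>

lemma nonlocal_walk:
  assumes P: "P \<in> proper_ideals R" and Q: "Q \<in> proper_ideals R"
    and PQ: "Idl (P \<union> Q) = carrier R"
    and A: "A \<in> proper_ideals R" and B: "B \<in> proper_ideals R"
  shows "(A, B) \<in> ((parcs (GF R))\<^sup>=) ^^ 4"
proof -
  have "\<one> \<in> P <+>\<^bsub>R\<^esub> Q"
    using PQ union_genideal[OF P[THEN proper_idealsD(1)] Q[THEN proper_idealsD(1)]] by simp
  then obtain p q where pq: "p \<in> P" "q \<in> Q" "\<one> = p \<oplus> q"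
    by (auto simp: set_add_def')
  have c: "p \<in> carrier R" "q \<in> carrier R" using pq proper_idealsD(2)[OF P] proper_idealsD(2)[OF Q] by auto
  note sub = proper_idealsD(2)[OF A] proper_idealsD(2)[OF B]
  let ?X = "\<lambda>C x. Idl (C \<union> {x})"
  have ext: "fg_extension R C (?X C x)" if "x \<in> carrier R" for C x
    unfolding fg_extension_def using that by (intro exI[of _ "{x}"]) simp
  have self: "C \<union> {x} \<subseteq> ?X C x" if "C \<subseteq> carrier R" "x \<in> carrier R" for C x
    using that by (intro genideal_self) auto
  have id: "ideal (?X C x) R" if "C \<subseteq> carrier R" "x \<in> carrier R" for C x
    using that by (intro genideal_ideal) auto
  have pr: "?X C x \<in> proper_ideals R"
    if "C \<in> proper_ideals R" "x \<in> carrier R" "?X C x \<noteq> carrier R" for C x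
    using that id[of C x] by (auto simp: proper_ideals_def ideal_subset_carrier)
  have whole: "Idl (C \<union> D) = carrier R"
    if "ideal C R" "ideal D R" "p \<in> C \<and> q \<in> D \<or> q \<in> C \<and> p \<in> D" for C D
  proof -
    have "C \<union> D \<subseteq> carrier R" using that(1,2)[THEN ideal_subset_carrier] by auto
    then have i: "ideal (Idl (C \<union> D)) R" and "C \<union> D \<subseteq> Idl (C \<union> D)"
      by (rule genideal_ideal, rule genideal_self)
    then have "p \<oplus> q \<in> Idl (C \<union> D)"
      using that(3) additive_subgroup.a_closed[OF ideal.axioms(1)[OF i]] by auto
    then show ?thesis using ideal.one_imp_carrier[OF i] pq(3) by simp
  qed
  have two: "(A, B) \<in> ((parcs (GF R))\<^sup>=) ^^ 4"
    if x: "x \<in> N" "N \<in> proper_ideals R" "?X A x = carrier R" "?X B x = carrier R" for x N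
  proof -
    have N: "Idl (C \<union> N) = carrier R" if "C \<in> proper_ideals R" "?X C x = carrier R" for C
    proof -
      have "C \<union> N \<subseteq> carrier R" using proper_idealsD(2)[OF x(2)] proper_idealsD(2)[OF that(1)] by auto
      then have i: "ideal (Idl (C \<union> N)) R" and "C \<union> N \<subseteq> Idl (C \<union> N)"
        by (rule genideal_ideal, rule genideal_self)
      then have "?X C x \<subseteq> Idl (C \<union> N)" using x(1) by (intro genideal_minimal) auto
      then show ?thesis
        using that(2) ideal_subset_carrier[OF i] by auto
    qed
    show ?thesis using comaximal_common_walk[OF A B x(2)] N[OF A x(3)] N[OF B x(4)] by simp
  qed
  have one: "Idl (C \<union> ?X D x) = carrier R"
    if "C \<in> proper_ideals R" "D \<in> proper_ideals R" "x \<in> carrier R" "?X C x = carrier R" for C D x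
  proof -
    have cs: "C \<subseteq> carrier R" "D \<subseteq> carrier R" using that(1,2)[THEN proper_idealsD(2)] by auto
    then have "C \<union> ?X D x \<subseteq> carrier R" using cs(1) ideal_subset_carrier[OF id[OF cs(2) that(3)]] by auto
    then have i: "ideal (Idl (C \<union> ?X D x)) R" and "C \<union> ?X D x \<subseteq> Idl (C \<union> ?X D x)"
      by (rule genideal_ideal, rule genideal_self)
    then have "?X C x \<subseteq> Idl (C \<union> ?X D x)"
      using self[OF cs(2) that(3)] by (intro genideal_minimal) auto
    then show ?thesis using that(4) ideal_subset_carrier[OF i] by auto
  qed
  note refl = fg_extension_refl[OF proper_idealsD(1)]
  consider "?X A p = carrier R" "?X B p = carrier R"
    | "?X A p = carrier R" "?X B p \<noteq> carrier R"
    | "?X A p \<noteq> carrier R" "?X B p = carrier R"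
    | "?X A p \<noteq> carrier R" "?X B q \<noteq> carrier R"
    | "?X A q \<noteq> carrier R" "?X B p \<noteq> carrier R"
    | "?X A q = carrier R" "?X B q = carrier R"
    by blast
  then show ?thesis
  proof cases
    case 1 then show ?thesis using two[OF pq(1) P] by simp
  next
    case 2
    then show ?thesis
      using comaximal_extensions_walk[OF A A refl[OF A] B pr[OF B c(1)] ext[OF c(1)]]
        one[OF A B c(1)] by simp
  next
    case 3
    then have "Idl (?X A p \<union> B) = carrier R" using one[OF B A c(1)] by (simp add: Un_commute)
    then show ?thesis
      using comaximal_extensions_walk[OF A pr[OF A c(1)] ext[OF c(1)] B B refl[OF B]] 3 by simp
  next
    case 4
    then show ?thesis
      using comaximal_extensions_walk[OF A pr[OF A c(1)] ext[OF c(1)] B pr[OF B c(2)] ext[OF c(2)]]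
        whole[OF id[OF sub(1) c(1)] id[OF sub(2) c(2)]] self[OF sub(1) c(1)] self[OF sub(2) c(2)]
      by simp
  next
    case 5
    then show ?thesis
      using comaximal_extensions_walk[OF A pr[OF A c(2)] ext[OF c(2)] B pr[OF B c(1)] ext[OF c(1)]]
        whole[OF id[OF sub(1) c(2)] id[OF sub(2) c(1)]] self[OF sub(1) c(2)] self[OF sub(2) c(1)]
      by simp
  next
    case 6 then show ?thesis using two[OF pq(2) Q] by simp
  qed
qed

lemma diam_GF_le_4_or_infinite: "diam_GF R \<le> ereal (real 4) \<or> diam_GF R = \<infinity>"
proof (cases "\<exists>P\<in>proper_ideals R. \<exists>Q\<in>proper_ideals R. Idl (P \<union> Q) = carrier R")
  case True
  then obtain P Q where PQ: "P \<in> proper_ideals R" "Q \<in> proper_ideals R"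
    "Idl (P \<union> Q) = carrier R"
    by auto
  have "diam_GF R \<le> ereal (real 4)"
    unfolding graph_diam_le_iff[OF wf_digraph_GF] pverts_GF using nonlocal_walk[OF PQ] by simp
  then show ?thesis ..
next
  case False
  then have local: "Idl (A \<union> B) \<noteq> carrier R"
    if "A \<in> proper_ideals R" "B \<in> proper_ideals R" for A B
    using that by blast
  show ?thesis
  proof (cases "\<forall>A\<in>proper_ideals R. \<forall>B\<in>proper_ideals R. \<exists>n. (A, B) \<in> ((parcs (GF R))\<^sup>=) ^^ n")
    case True
    have "(A, B) \<in> ((parcs (GF R))\<^sup>=) ^^ 2"
      if AB: "A \<in> proper_ideals R" "B \<in> proper_ideals R" for A B
    proof -
      obtain U where "U \<in> proper_ideals R" "fg_extension R A U" "fg_extension R B U"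
        using True AB local_common_extension[OF local AB(1)] by meson
      then show ?thesis
        using GF_reflclI(1)[OF AB(1)] GF_reflclI(2)[OF AB(2)] unfolding relpow_2_iff by iprover
    qed
    then have "diam_GF R \<le> ereal (real 2)"
      by (simp add: graph_diam_le_iff[OF wf_digraph_GF] pverts_GF del: of_nat_numeral)
    also have "\<dots> \<le> ereal (real 4)" by simp
    finally show ?thesis ..
  next
    case False
    then obtain A B where "A \<in> proper_ideals R" "B \<in> proper_ideals R"
      "\<And>n. (A, B) \<notin> ((parcs (GF R))\<^sup>=) ^^ n"
      by blast
    then show ?thesis
      using graph_diam_infinite[OF wf_digraph_GF, of A R B] by (simp add: pverts_GF)
  qed
qed

end

theorem theorem6p19:
  fixes R :: "('a, 'm) ring_scheme" and I :: "'a set" and n :: nat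
  assumes "cring R"
    and "ideal I R" and "I \<noteq> carrier R"
    and "diam_GF R = ereal (real n)"
  shows "(n \<le> 2 \<longrightarrow> diam_GF (R Quot I) \<le> ereal (real n)) \<and>
         (n = 3 \<longrightarrow> diam_GF (R Quot I) \<le> ereal (real n)) \<and>
         (n = 4 \<longrightarrow> diam_GF (R Quot I) \<le> ereal (real n) \<or> diam_GF (R Quot I) = \<infinity>)"
proof -
  interpret cring R by fact
  interpret Q: cring "R Quot I"
    using ideal.quotient_is_cring[OF assms(2,1)] .
  have "n \<le> 3 \<Longrightarrow> diam_GF (R Quot I) \<le> ereal (real n)"
    using diam_GF_quotient_le[OF assms(2)] assms(4) by simp
  then show ?thesis using Q.diam_GF_le_4_or_infinite by auto
qed

end
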